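(* Let $H$ be a finite group, let $S\subseteq H$ with $1\in S$, and let $\Gamma=\mathrm{BiCay}(H,\emptyset,\emptyset,S)$ be connected. Then $N_{\mathrm{Aut}(\Gamma)}(R(H))$ acts transitively on the $2$-arcs of $\Gamma$ if and only if the following three conditions hold: (a) there exists an automorphism $\alpha$ of $H$ such that $S^{\alpha}=S^{-1}$; (b) the setwise stabiliser of $S\setminus\{1\}$ in $\mathrm{Aut}(H)$ is transitive on $S\setminus\{1\}$; and (c) there exist $s\in S\setminus\{1\}$ and an automorphism $\beta$ of $H$ such that $S^{\beta}=s^{-1}S$. Furthermore, $N_{\mathrm{Aut}(\Gamma)}(R(H))$ is not transitive on the $3$-arcs of $\Gamma$.
   Context: All graphs are finite, simple and undirected. For a group $H$ and $S\subseteq H$, the bi-Cayley graph $\mathrm{BiCay}(H,\emptyset,\emptyset,S)$ has vertex set the disjoint union of two copies $H_0=\{h_0: h\in H\}$ and $H_1=\{h_1:h\in H\}$ of $H$, and its edges are the pairs $\{h_0,(zh)_1\}$ with $h\in H$, $z\in S$. For $g\in H$, $R(g)$ is the automorphism $h_i\mapsto (hg)_i$ ($i\in\{0,1\}$, $h\in H$), and $R(H)=\{R(g):g\in H\}\le \mathrm{Aut}(\Gamma)$. $N_{\mathrm{Aut}(\Gamma)}(R(H))$ is the normaliser of $R(H)$ in $\mathrm{Aut}(\Gamma)$. For $\alpha\in\mathrm{Aut}(H)$, $S^\alpha$ is the image of $S$ under $\alpha$, and $S^{-1}=\{s^{-1}:s\in S\}$. An $s$-arc is an ordered $(s+1)$-tuple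 $(v_0,\dots,v_s)$ of vertices with consecutive vertices adjacent and $v_{i-1}\ne v_{i+1}$ for $1\le i\le s-1$.
   Formalization: The 3-arc claim is proved for |S| ≠ 2 only, since for |S| = 2 the graph is a cycle and the normaliser is transitive on its 3-arcs; transitive means exactly one orbit, so an action on an empty set (|S| = 1) is not transitive. *)

theory Defs
  imports "HOL-Algebra.Group_Action"
begin

text \<open>Finite simple undirected graphs, given by a vertex set and a set of two-element vertex sets.\<close>

record 'v sgraph =
  verts :: "'v set"
  edges :: "'v set set"

definition sgraph :: "'v sgraph \<Rightarrow> bool" where
  "sgraph \<Gamma> \<longleftrightarrow> finite (verts \<Gamma>) \<and> (\<forall>e \<in> edges \<Gamma>. e \<subseteq> verts \<Gamma> \<and> card e = 2)"

definition adj :: "'v sgraph \<Rightarrow> 'v \<Rightarrow> 'v \<Rightarrow> bool" where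
  "adj \<Gamma> u v \<longleftrightarrow> {u, v} \<in> edges \<Gamma>"

definition graph_connected :: "'v sgraph \<Rightarrow> bool" where
  "graph_connected \<Gamma> \<longleftrightarrow> verts \<Gamma> \<noteq> {} \<and> (\<forall>u \<in> verts \<Gamma>. \<forall>v \<in> verts \<Gamma>. (adj \<Gamma>)\<^sup>*\<^sup>* u v)"

text \<open>
  The product is composition of functions from right to left, as in \<^const>\<open>BijGroup\<close>;
  automorphisms are extensional on the vertex set.
\<close>

definition graph_aut :: "'v sgraph \<Rightarrow> ('v \<Rightarrow> 'v) set" where
  "graph_aut \<Gamma> = {f \<in> Bij (verts \<Gamma>).
     \<forall>u \<in> verts \<Gamma>. \<forall>v \<in> verts \<Gamma>. adj \<Gamma> (f u) (f v) \<longleftrightarrow> adj \<Gamma> u v}"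

definition GraphAut :: "'v sgraph \<Rightarrow> ('v \<Rightarrow> 'v) monoid" where
  "GraphAut \<Gamma> = BijGroup (verts \<Gamma>) \<lparr>carrier := graph_aut \<Gamma>\<rparr>"

definition arcs :: "'v sgraph \<Rightarrow> nat \<Rightarrow> 'v list set" where
  "arcs \<Gamma> s = {p. length p = s + 1 \<and> set p \<subseteq> verts \<Gamma> \<and>
     (\<forall>i < s. adj \<Gamma> (p ! i) (p ! (i + 1))) \<and>
     (\<forall>i. 1 \<le> i \<and> i \<le> s - 1 \<longrightarrow> p ! (i - 1) \<noteq> p ! (i + 1))}"

definition arc_action :: "'v sgraph \<Rightarrow> nat \<Rightarrow> ('v \<Rightarrow> 'v) \<Rightarrow> 'v list \<Rightarrow> 'v list" where
  "arc_action \<Gamma> s f = (\<lambda>p \<in> arcs \<Gamma> s. map f p)"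

text \<open>
  A transitive action has exactly one orbit. In contrast to \<^locale>\<open>transitive_action\<close> alone,
  this rules out the action on the empty set, which has no orbit.
\<close>

definition acts_transitively :: "('g, 'm) monoid_scheme \<Rightarrow> 'x set \<Rightarrow> ('g \<Rightarrow> 'x \<Rightarrow> 'x) \<Rightarrow> bool" where
  "acts_transitively G X \<phi> \<longleftrightarrow> transitive_action G X \<phi> \<and> X \<noteq> {}"

definition transitive_on_arcs :: "'v sgraph \<Rightarrow> ('v \<Rightarrow> 'v) set \<Rightarrow> nat \<Rightarrow> bool" where
  "transitive_on_arcs \<Gamma> A s \<longleftrightarrow>
     acts_transitively (GraphAut \<Gamma> \<lparr>carrier := A\<rparr>) (arcs \<Gamma> s) (arc_action \<Gamma> s)"

text \<open>
  The bi-Cayley graph \<open>BiCay(H, \<emptyset>, \<emptyset>, S)\<close>: the vertex \<open>h\<^sub>0\<close> is \<open>Inl h\<close> and the vertex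
  \<open>h\<^sub>1\<close> is \<open>Inr h\<close>.
\<close>

definition bicay :: "('a, 'm) monoid_scheme \<Rightarrow> 'a set \<Rightarrow> ('a + 'a) sgraph" where
  "bicay H S = \<lparr>verts = carrier H <+> carrier H,
     edges = {{Inl h, Inr (z \<otimes>\<^bsub>H\<^esub> h)} | h z. h \<in> carrier H \<and> z \<in> S}\<rparr>"

definition right_mult :: "('a, 'm) monoid_scheme \<Rightarrow> 'a \<Rightarrow> 'a + 'a \<Rightarrow> 'a + 'a" where
  "right_mult H g = (\<lambda>v \<in> carrier H <+> carrier H.
     map_sum (\<lambda>h. h \<otimes>\<^bsub>H\<^esub> g) (\<lambda>h. h \<otimes>\<^bsub>H\<^esub> g) v)"

definition RH :: "('a, 'm) monoid_scheme \<Rightarrow> ('a + 'a \<Rightarrow> 'a + 'a) set" where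
  "RH H = right_mult H ` carrier H"

definition aut_set_stabilizer :: "('a, 'm) monoid_scheme \<Rightarrow> 'a set \<Rightarrow> ('a \<Rightarrow> 'a) set" where
  "aut_set_stabilizer H T = {\<alpha> \<in> auto H. \<alpha> ` T = T}"


text \<open>
  The next lemmas show that the groups and actions above are genuine ones, so that
  the \<^locale>\<open>group_action\<close> part of \<^const>\<open>acts_transitively\<close> always holds in these cases.
\<close>

lemma sgraph_bicay:
  assumes "group H" "finite (carrier H)" "S \<subseteq> carrier H"
  shows "sgraph (bicay H S)"
proof -
  interpret group H by fact
  show ?thesis
    using assms(2,3) by (auto simp: sgraph_def bicay_def)
qed

lemma subgroup_graph_aut: "subgroup (graph_aut \<Gamma>) (BijGroup (verts \<Gamma>))"
proof (rule group.subgroupI[OF group_BijGroup])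
  show "graph_aut \<Gamma> \<subseteq> carrier (BijGroup (verts \<Gamma>))"
    by (auto simp: graph_aut_def BijGroup_def)
  show "graph_aut \<Gamma> \<noteq> {}"
    using id_Bij[of "verts \<Gamma>"] by (auto simp: graph_aut_def)
next
  fix f assume f: "f \<in> graph_aut \<Gamma>"
  let ?g = "restrict (inv_into (verts \<Gamma>) f) (verts \<Gamma>)"
  have B: "f \<in> Bij (verts \<Gamma>)" using f by (simp add: graph_aut_def)
  have "adj \<Gamma> (?g u) (?g v) \<longleftrightarrow> adj \<Gamma> u v" if "u \<in> verts \<Gamma>" "v \<in> verts \<Gamma>" for u v
  proof -
    have im: "f ` verts \<Gamma> = verts \<Gamma>" using B by (simp add: Bij_def bij_betw_def)
    have "?g u \<in> verts \<Gamma>" "?g v \<in> verts \<Gamma>" "f (?g u) = u" "f (?g v) = v"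
      using that B im by (auto simp: Bij_inv_into_mem f_inv_into_f)
    then show ?thesis using f unfolding graph_aut_def by (smt (verit) mem_Collect_eq)
  qed
  then show "inv\<^bsub>BijGroup (verts \<Gamma>)\<^esub> f \<in> graph_aut \<Gamma>"
    using B by (simp add: inv_BijGroup graph_aut_def restrict_inv_into_Bij del: restrict_apply)
next
  fix f g assume f: "f \<in> graph_aut \<Gamma>" and g: "g \<in> graph_aut \<Gamma>"
  then have B: "f \<in> Bij (verts \<Gamma>)" "g \<in> Bij (verts \<Gamma>)" by (auto simp: graph_aut_def)
  have "g u \<in> verts \<Gamma>" if "u \<in> verts \<Gamma>" for u
    using Bij_imp_funcset[OF B(2)] that by auto
  then show "f \<otimes>\<^bsub>BijGroup (verts \<Gamma>)\<^esub> g \<in> graph_aut \<Gamma>"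
    using f g B by (auto simp: BijGroup_def graph_aut_def compose_Bij compose_eq)
qed

lemma group_GraphAut: "group (GraphAut \<Gamma>)"
  unfolding GraphAut_def
  by (rule subgroup.subgroup_is_group[OF subgroup_graph_aut group_BijGroup])

lemma arcs_map:
  assumes "f \<in> graph_aut \<Gamma>" "p \<in> arcs \<Gamma> s"
  shows "map f p \<in> arcs \<Gamma> s"
proof -
  have B: "f \<in> verts \<Gamma> \<rightarrow> verts \<Gamma>" "inj_on f (verts \<Gamma>)"
    using assms(1) by (auto simp: graph_aut_def Bij_def bij_betw_def)
  have p: "length p = s + 1" "set p \<subseteq> verts \<Gamma>" using assms(2) by (auto simp: arcs_def)
  have v: "p ! i \<in> verts \<Gamma>" if "i \<le> s" for i
    using p that by (metis Suc_eq_plus1 le_imp_less_Suc nth_mem subsetD)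
  have "adj \<Gamma> (map f p ! i) (map f p ! (i + 1))" if "i < s" for i
  proof -
    have "adj \<Gamma> (p ! i) (p ! (i + 1))" using assms(2) that by (auto simp: arcs_def)
    moreover have "p ! i \<in> verts \<Gamma>" "p ! (i + 1) \<in> verts \<Gamma>" using v that by auto
    ultimately show ?thesis
      using assms(1) that p(1) by (auto simp: graph_aut_def)
  qed
  moreover have "map f p ! (i - 1) \<noteq> map f p ! (i + 1)" if "1 \<le> i" "i \<le> s - 1" for i
  proof -
    have "p ! (i - 1) \<noteq> p ! (i + 1)" using assms(2) that by (auto simp: arcs_def)
    moreover have "p ! (i - 1) \<in> verts \<Gamma>" "p ! (i + 1) \<in> verts \<Gamma>" using v that by auto
    ultimately show ?thesis
      using B(2) that p(1) by (auto dest: inj_onD)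
  qed
  ultimately show ?thesis
    using p B(1) by (auto simp: arcs_def)
qed

lemma arc_action_compose:
  assumes "f \<in> graph_aut \<Gamma>" "g \<in> graph_aut \<Gamma>"
  shows "arc_action \<Gamma> s (compose (verts \<Gamma>) f g) = compose (arcs \<Gamma> s) (arc_action \<Gamma> s f) (arc_action \<Gamma> s g)"
proof
  fix p
  show "arc_action \<Gamma> s (compose (verts \<Gamma>) f g) p
      = compose (arcs \<Gamma> s) (arc_action \<Gamma> s f) (arc_action \<Gamma> s g) p"
  proof (cases "p \<in> arcs \<Gamma> s")
    case True
    then have "set p \<subseteq> verts \<Gamma>" by (simp add: arcs_def)
    then have "map (compose (verts \<Gamma>) f g) p = map f (map g p)"
      by (auto simp: compose_eq)
    then show ?thesis
      using True arcs_map[OF assms(2) True] by (simp add: arc_action_def compose_eq)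
  qed (simp add: arc_action_def compose_def)
qed

lemma arc_action_Bij:
  assumes f: "f \<in> graph_aut \<Gamma>"
  shows "arc_action \<Gamma> s f \<in> Bij (arcs \<Gamma> s)"
proof -
  let ?g = "restrict (inv_into (verts \<Gamma>) f) (verts \<Gamma>)"
  have B: "f \<in> Bij (verts \<Gamma>)" using f by (simp add: graph_aut_def)
  have g: "?g \<in> graph_aut \<Gamma>"
    using subgroup.m_inv_closed[OF subgroup_graph_aut f] inv_BijGroup[OF B] by simp
  have v: "set p \<subseteq> verts \<Gamma>" if "p \<in> arcs \<Gamma> s" for p using that by (simp add: arcs_def)
  have im: "f ` verts \<Gamma> = verts \<Gamma>" "inj_on f (verts \<Gamma>)"
    using B by (auto simp: Bij_def bij_betw_def)
  have 1: "map ?g (map f p) = p" if "p \<in> arcs \<Gamma> s" for p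
    using v[OF that] im by (auto intro!: map_idI simp: subset_iff inv_into_f_f)
  have 2: "map f (map ?g p) = p" if "p \<in> arcs \<Gamma> s" for p
    using v[OF that] im by (auto intro!: map_idI simp: f_inv_into_f)
  have "bij_betw (map f) (arcs \<Gamma> s) (arcs \<Gamma> s)"
    by (rule bij_betw_byWitness[where f' = "map ?g"])
      (use 1 2 arcs_map[OF f] arcs_map[OF g] in blast)+
  then show ?thesis
    by (simp add: Bij_def arc_action_def cong: bij_betw_cong)
qed

lemma group_action_arcs:
  assumes "subgroup A (GraphAut \<Gamma>)"
  shows "group_action (GraphAut \<Gamma> \<lparr>carrier := A\<rparr>) (arcs \<Gamma> s) (arc_action \<Gamma> s)"
proof -
  have A: "A \<subseteq> graph_aut \<Gamma>"
    using subgroup.subset[OF assms] by (simp add: GraphAut_def)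
  have "arc_action \<Gamma> s \<in> hom (GraphAut \<Gamma> \<lparr>carrier := A\<rparr>) (BijGroup (arcs \<Gamma> s))"
  proof (rule homI)
    fix f assume "f \<in> carrier (GraphAut \<Gamma> \<lparr>carrier := A\<rparr>)"
    then show "arc_action \<Gamma> s f \<in> carrier (BijGroup (arcs \<Gamma> s))"
      using A arc_action_Bij by (auto simp: BijGroup_def)
  next
    fix f g
    assume "f \<in> carrier (GraphAut \<Gamma> \<lparr>carrier := A\<rparr>)" "g \<in> carrier (GraphAut \<Gamma> \<lparr>carrier := A\<rparr>)"
    then have fg: "f \<in> graph_aut \<Gamma>" "g \<in> graph_aut \<Gamma>" using A by auto
    moreover have "f \<in> Bij (verts \<Gamma>)" "g \<in> Bij (verts \<Gamma>)" using fg by (auto simp: graph_aut_def)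
    ultimately show "arc_action \<Gamma> s (f \<otimes>\<^bsub>GraphAut \<Gamma> \<lparr>carrier := A\<rparr>\<^esub> g)
        = arc_action \<Gamma> s f \<otimes>\<^bsub>BijGroup (arcs \<Gamma> s)\<^esub> arc_action \<Gamma> s g"
      by (simp add: GraphAut_def BijGroup_def arc_action_compose arc_action_Bij)
  qed
  then show ?thesis
    using subgroup.subgroup_is_group[OF assms group_GraphAut] group_BijGroup
    by (simp add: group_action_def group_hom_def group_hom_axioms_def)
qed

lemma RH_subset:
  assumes "group H" "S \<subseteq> carrier H"
  shows "RH H \<subseteq> graph_aut (bicay H S)"
proof
  interpret group H by fact
  fix f assume "f \<in> RH H"
  then obtain g where g: "g \<in> carrier H" and f: "f = right_mult H g" by (auto simp: RH_def)
  let ?V = "carrier H <+> carrier H"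
  let ?f = "map_sum (\<lambda>h. h \<otimes>\<^bsub>H\<^esub> g) (\<lambda>h. h \<otimes>\<^bsub>H\<^esub> g)"
  let ?f' = "map_sum (\<lambda>h. h \<otimes>\<^bsub>H\<^esub> inv\<^bsub>H\<^esub> g) (\<lambda>h. h \<otimes>\<^bsub>H\<^esub> inv\<^bsub>H\<^esub> g)"
  have "bij_betw ?f ?V ?V"
    by (rule bij_betw_byWitness[where f' = ?f']) (auto simp: g m_assoc)
  then have "f \<in> Bij ?V"
    by (simp add: Bij_def f right_mult_def cong: bij_betw_cong)
  moreover have *: "adj (bicay H S) (Inl a) (Inr b) \<longleftrightarrow> (\<exists>z\<in>S. b = z \<otimes>\<^bsub>H\<^esub> a)"
      "adj (bicay H S) (Inr b) (Inl a) \<longleftrightarrow> (\<exists>z\<in>S. b = z \<otimes>\<^bsub>H\<^esub> a)"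
    if "a \<in> carrier H" for a b
    using that by (auto simp: adj_def bicay_def doubleton_eq_iff)
  moreover have "\<not> adj (bicay H S) (Inl a) (Inl b)" "\<not> adj (bicay H S) (Inr a) (Inr b)" for a b
    by (auto simp: adj_def bicay_def doubleton_eq_iff)
  moreover have "(\<exists>z\<in>S. b \<otimes>\<^bsub>H\<^esub> g = z \<otimes>\<^bsub>H\<^esub> (a \<otimes>\<^bsub>H\<^esub> g)) \<longleftrightarrow> (\<exists>z\<in>S. b = z \<otimes>\<^bsub>H\<^esub> a)"
    if "a \<in> carrier H" "b \<in> carrier H" for a b
  proof -
    have "b \<otimes>\<^bsub>H\<^esub> g = z \<otimes>\<^bsub>H\<^esub> (a \<otimes>\<^bsub>H\<^esub> g) \<longleftrightarrow> b = z \<otimes>\<^bsub>H\<^esub> a" if "z \<in> S" for z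
    proof -
      have "z \<in> carrier H" using that assms(2) by auto
      then show ?thesis
        using \<open>a \<in> carrier H\<close> \<open>b \<in> carrier H\<close> g
        by (simp add: m_assoc[symmetric])
    qed
    then show ?thesis by blast
  qed
  ultimately show "f \<in> graph_aut (bicay H S)"
    using g by (auto simp: graph_aut_def f right_mult_def bicay_def[of H S, THEN arg_cong[of _ _ verts]])
qed

lemma subgroup_normalizer_RH:
  assumes "group H" "S \<subseteq> carrier H"
  shows "subgroup (normalizer (GraphAut (bicay H S)) (RH H)) (GraphAut (bicay H S))"
  by (rule group.normalizer_imp_subgroup[OF group_GraphAut])
    (use RH_subset[OF assms] in \<open>simp add: GraphAut_def\<close>)

lemma group_action_aut_set_stabilizer:
  assumes "group H" "T \<subseteq> carrier H"
  shows "group_action (AutoGroup H \<lparr>carrier := aut_set_stabilizer H T\<rparr>) T (\<lambda>\<alpha>. restrict \<alpha> T)"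
proof -
  interpret group H by fact
  let ?B = "BijGroup (carrier H)"
  let ?A = "aut_set_stabilizer H T"
  have AB: "\<alpha> \<in> Bij (carrier H)" if "\<alpha> \<in> ?A" for \<alpha>
    using that by (simp add: aut_set_stabilizer_def auto_def)
  have comp: "compose (carrier H) f g ` T = f ` g ` T" for f g :: "'a \<Rightarrow> 'a"
    using assms(2) by (force simp: compose_def)
  have "subgroup ?A ?B"
  proof (rule group.subgroupI[OF group_BijGroup])
    show "?A \<subseteq> carrier ?B" using AB by (auto simp: BijGroup_def)
    have "(\<lambda>x\<in>carrier H. x) ` T = T" using assms(2) by force
    then have "(\<lambda>x\<in>carrier H. x) \<in> ?A"
      using id_in_auto by (simp add: aut_set_stabilizer_def)
    then show "?A \<noteq> {}" by blast
  next
    fix f assume f: "f \<in> ?A"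
    then have inv: "inv\<^bsub>?B\<^esub> f \<in> auto H"
      by (simp add: aut_set_stabilizer_def subgroup.m_inv_closed[OF subgroup_auto])
    have fi: "inj_on f (carrier H)" and fT: "f ` T = T"
      using f by (auto simp: aut_set_stabilizer_def auto_def Bij_def bij_betw_def)
    have "(\<lambda>x\<in>carrier H. inv_into (carrier H) f x) ` T = inv_into (carrier H) f ` (f ` T)"
      using assms(2) fT by (auto simp: subset_iff image_iff intro!: bexI)
    also have "\<dots> = T" using fi assms(2) by simp
    finally show "inv\<^bsub>?B\<^esub> f \<in> ?A"
      using inv inv_BijGroup[OF AB[OF f]] by (simp add: aut_set_stabilizer_def)
  next
    fix f g assume f: "f \<in> ?A" and g: "g \<in> ?A"
    then have "f \<otimes>\<^bsub>?B\<^esub> g \<in> auto H"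
      by (simp add: aut_set_stabilizer_def subgroup.m_closed[OF subgroup_auto])
    moreover have "f \<otimes>\<^bsub>?B\<^esub> g = compose (carrier H) f g"
      using AB f g by (simp add: BijGroup_def)
    ultimately show "f \<otimes>\<^bsub>?B\<^esub> g \<in> ?A"
      using f g comp by (auto simp: aut_set_stabilizer_def)
  qed
  then have "group (?B \<lparr>carrier := ?A\<rparr>)"
    by (rule subgroup.subgroup_is_group[OF _ group_BijGroup])
  moreover have "(\<lambda>\<alpha>. restrict \<alpha> T) \<in> hom (?B \<lparr>carrier := ?A\<rparr>) (BijGroup T)"
  proof -
    have rB: "restrict f T \<in> Bij T" if "f \<in> ?A" for f
      using that assms(2)
      by (auto simp: aut_set_stabilizer_def auto_def Bij_def bij_betw_def inj_on_subset)
    have "restrict (compose (carrier H) f g) T = compose T (restrict f T) (restrict g T)"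
      if "f \<in> ?A" "g \<in> ?A" for f g
    proof -
      have "g x \<in> T" if "x \<in> T" for x using that \<open>g \<in> ?A\<close> by (auto simp: aut_set_stabilizer_def)
      then show ?thesis using assms(2) by (auto simp: compose_def fun_eq_iff)
    qed
    then show ?thesis
      by (auto intro!: homI simp: BijGroup_def rB AB)
  qed
  ultimately show ?thesis
    by (simp add: AutoGroup_def group_action_def group_hom_def group_hom_axioms_def group_BijGroup)
qed

end

theory Submission
  imports Defs
begin

text \<open>
  Write \<open>h\<^sub>0\<close> and \<open>h\<^sub>1\<close> for \<open>Inl h\<close> and \<open>Inr h\<close>. An element \<open>f\<close> of the normaliser \<open>N\<close> of \<open>R(H)\<close>
  induces by conjugation an automorphism \<open>\<sigma>\<close> of \<open>H\<close> with \<open>f (v R(g)) = (f v) R(\<sigma> g)\<close>. As \<open>R(H)\<close> is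
  regular on each of the two copies of \<open>H\<close>, the map \<open>f\<close> is determined by \<open>\<sigma>\<close> and by the images of
  \<open>1\<^sub>0\<close> and \<open>1\<^sub>1\<close>, and preserving adjacency becomes one equation between translates of \<open>\<sigma> S\<close> and
  of \<open>S\<close> or its inverse. Two families of such maps carry the proof.

  \<^item> If \<open>f\<close> fixes \<open>1\<^sub>0\<close> and sends \<open>1\<^sub>1\<close> to \<open>z\<^sub>1\<close>, then \<open>f h\<^sub>0 = (\<sigma> h)\<^sub>0\<close> and \<open>f h\<^sub>1 = (z \<sigma> h)\<^sub>1\<close>,
    and the condition on \<open>\<sigma>\<close> is \<open>\<sigma> S = z\<^sup>-\<^sup>1 S\<close>. Condition (b) concerns the case \<open>z = 1\<close>,
    condition (c) the case \<open>z \<noteq> 1\<close>.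
  \<^item> If \<open>f\<close> interchanges \<open>1\<^sub>0\<close> and \<open>1\<^sub>1\<close>, then \<open>f h\<^sub>0 = (\<sigma> h)\<^sub>1\<close> and \<open>f h\<^sub>1 = (\<sigma> h)\<^sub>0\<close>,
    and the condition on \<open>\<sigma>\<close> is \<open>\<sigma> S = S\<^sup>-\<^sup>1\<close>. This is condition (a).

  Given transitivity on 2-arcs, (a), (b) and (c) are read off from elements of \<open>N\<close> that take
  \<open>(1\<^sub>1, 1\<^sub>0, s\<^sub>1)\<close>, where \<open>s\<close> and \<open>t\<close> are in \<open>S - {1}\<close>, to \<open>(1\<^sub>0, 1\<^sub>1, (s\<^sup>-\<^sup>1)\<^sub>0)\<close>, to \<open>(1\<^sub>1, 1\<^sub>0, t\<^sub>1)\<close>, and to its own reverse. Conversely, a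
  2-arc is brought to the form \<open>(1\<^sub>1, 1\<^sub>0, s\<^sub>1)\<close> for a fixed \<open>s\<close>: (a) and a right
  multiplication move its middle vertex to \<open>1\<^sub>0\<close>, (b) and (c) move its first vertex to \<open>1\<^sub>1\<close>,
  and (b) then moves its last vertex to \<open>s\<^sub>1\<close>.

  For 3-arcs, consider \<open>(x\<^sub>1, 1\<^sub>0, 1\<^sub>1, (t\<^sup>-\<^sup>1)\<^sub>0)\<close> with \<open>x\<close> and \<open>t\<close> in \<open>S - {1}\<close>. An element of \<open>N\<close> fixing
  \<open>1\<^sub>0\<close> and \<open>1\<^sub>1\<close> acts on both ends through the same \<open>\<sigma>\<close>, so it cannot take such an arc with \<open>x = t\<close>
  to one with \<open>x \<noteq> t\<close>.
\<close>

section \<open>Normalisers and transitivity\<close>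

lemma (in group) mem_normalizer_iff:
  assumes A: "A \<subseteq> carrier G"
  shows "f \<in> normalizer G A \<longleftrightarrow> f \<in> carrier G \<and> f <# A = A #> f"
proof -
  have "f <# A #> inv f = A \<longleftrightarrow> f <# A = A #> f" if f: "f \<in> carrier G"
  proof -
    have fA: "f <# A \<subseteq> carrier G"
      using f A by (rule l_coset_subset_G[rotated])
    show ?thesis
      using coset_mult_assoc[OF fA, of "inv f" f] coset_mult_assoc[OF A, of f "inv f"] f A fA
      by auto
  qed
  then show ?thesis
    using A by (auto simp: normalizer_def stabilizer_def)
qed

lemma transitive_on_arcs_iff:
  assumes "subgroup A (GraphAut \<Gamma>)"
  shows "transitive_on_arcs \<Gamma> A s \<longleftrightarrow>
    arcs \<Gamma> s \<noteq> {} \<and> (\<forall>p \<in> arcs \<Gamma> s. \<forall>q \<in> arcs \<Gamma> s. \<exists>f \<in> A. map f p = q)"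
  using group_action_arcs[OF assms, of s]
  by (auto simp: transitive_on_arcs_def acts_transitively_def transitive_action_def
      transitive_action_axioms_def arc_action_def)

lemma arcs_2_iff:
  "p \<in> arcs \<Gamma> 2 \<longleftrightarrow> (\<exists>u v w. p = [u, v, w] \<and> {u, v, w} \<subseteq> verts \<Gamma> \<and>
     adj \<Gamma> u v \<and> adj \<Gamma> v w \<and> u \<noteq> w)"
proof -
  have iff: "[u, v, w] \<in> arcs \<Gamma> 2 \<longleftrightarrow>
      {u, v, w} \<subseteq> verts \<Gamma> \<and> adj \<Gamma> u v \<and> adj \<Gamma> v w \<and> u \<noteq> w" for u v w
  proof -
    have "(\<forall>i < (2::nat). P i) \<longleftrightarrow> P 0 \<and> P 1"
      "(\<forall>i. 1 \<le> i \<and> i \<le> 2 - (1::nat) \<longrightarrow> P i) \<longleftrightarrow> P 1" for P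
      by (auto simp: less_2_cases_iff intro: le_antisym)
    then show ?thesis by (simp add: arcs_def)
  qed
  have triple: "\<exists>u v w. p = [u, v, w]" if "p \<in> arcs \<Gamma> 2"
    using that by (auto simp: arcs_def length_Suc_conv numeral_eq_Suc)
  show ?thesis
  proof
    assume p: "p \<in> arcs \<Gamma> 2"
    then obtain u v w where uvw: "p = [u, v, w]" using triple by blast
    show "\<exists>u v w. p = [u, v, w] \<and> {u, v, w} \<subseteq> verts \<Gamma> \<and>
        adj \<Gamma> u v \<and> adj \<Gamma> v w \<and> u \<noteq> w"
      by (intro exI conjI, rule uvw) (use p iff in \<open>simp_all add: uvw\<close>)
  next
    assume "\<exists>u v w. p = [u, v, w] \<and> {u, v, w} \<subseteq> verts \<Gamma> \<and>
        adj \<Gamma> u v \<and> adj \<Gamma> v w \<and> u \<noteq> w"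
    then show "p \<in> arcs \<Gamma> 2" by (elim exE conjE) (simp add: iff)
  qed
qed

lemma arcs_3_iff:
  "[u, v, w, x] \<in> arcs \<Gamma> 3 \<longleftrightarrow> {u, v, w, x} \<subseteq> verts \<Gamma> \<and>
     adj \<Gamma> u v \<and> adj \<Gamma> v w \<and> adj \<Gamma> w x \<and> u \<noteq> w \<and> v \<noteq> x"
proof -
  have "i < (3::nat) \<longleftrightarrow> i = 0 \<or> i = 1 \<or> i = 2" "1 \<le> i \<and> i \<le> 3 - (1::nat) \<longleftrightarrow> i = 1 \<or> i = 2" for i
    by auto
  then show ?thesis by (auto simp: arcs_def numeral_2_eq_2)
qed

section \<open>The normaliser of the right multiplications\<close>

locale bicayley = group H for H :: "('a, 'm) monoid_scheme" (structure) +
  fixes S :: "'a set"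
  assumes S_subset: "S \<subseteq> carrier H" and one_in_S: "\<one> \<in> S"
begin

abbreviation "\<Gamma> \<equiv> bicay H S"
abbreviation "V \<equiv> carrier H <+> carrier H"
abbreviation "N \<equiv> normalizer (GraphAut \<Gamma>) (RH H)"
abbreviation "R \<equiv> right_mult H"

lemma verts_bicay [simp]: "verts \<Gamma> = V"
  by (simp add: bicay_def)

lemma mem_V [simp]:
  "Inl a \<in> V \<longleftrightarrow> a \<in> carrier H" "Inr a \<in> V \<longleftrightarrow> a \<in> carrier H"
  by auto

lemma adj_Inl_Inr:
  assumes "a \<in> carrier H"
  shows "adj \<Gamma> (Inl a) (Inr b) \<longleftrightarrow> (\<exists>z \<in> S. b = z \<otimes> a)"
  using assms by (auto simp: adj_def bicay_def doubleton_eq_iff)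

lemma adj_sym: "adj \<Gamma> u v \<longleftrightarrow> adj \<Gamma> v u"
  by (simp add: adj_def insert_commute)

lemma not_adj_same_side [simp]:
  "\<not> adj \<Gamma> (Inl a) (Inl b)" "\<not> adj \<Gamma> (Inr a) (Inr b)"
  by (auto simp: adj_def bicay_def doubleton_eq_iff)

lemma adj_iff [simp]:
  assumes "a \<in> carrier H" "b \<in> carrier H"
  shows "adj \<Gamma> (Inl a) (Inr b) \<longleftrightarrow> b \<otimes> inv a \<in> S"
    and "adj \<Gamma> (Inr b) (Inl a) \<longleftrightarrow> b \<otimes> inv a \<in> S"
proof -
  show 1: "adj \<Gamma> (Inl a) (Inr b) \<longleftrightarrow> b \<otimes> inv a \<in> S"
  proof
    assume "adj \<Gamma> (Inl a) (Inr b)"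
    then obtain z where "z \<in> S" "b = z \<otimes> a" using adj_Inl_Inr assms by blast
    then show "b \<otimes> inv a \<in> S" using assms S_subset by (auto simp: m_assoc)
  next
    assume "b \<otimes> inv a \<in> S"
    moreover have "b = b \<otimes> inv a \<otimes> a" using assms by (simp add: m_assoc)
    ultimately show "adj \<Gamma> (Inl a) (Inr b)" using adj_Inl_Inr assms by blast
  qed
  then show "adj \<Gamma> (Inr b) (Inl a) \<longleftrightarrow> b \<otimes> inv a \<in> S"
    by (simp add: adj_sym)
qed

lemma right_mult_simps [simp]:
  "h \<in> carrier H \<Longrightarrow> R g (Inl h) = Inl (h \<otimes> g)"
  "h \<in> carrier H \<Longrightarrow> R g (Inr h) = Inr (h \<otimes> g)"
  by (auto simp: right_mult_def)

lemma right_mult_closed: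
  assumes "g \<in> carrier H" "v \<in> V"
  shows "R g v \<in> V"
  using assms by (cases v) auto

lemma right_mult_mult:
  assumes "g \<in> carrier H" "h \<in> carrier H" "v \<in> V"
  shows "R h (R g v) = R (g \<otimes> h) v"
  using assms by (cases v) (auto simp: m_assoc)

lemma right_mult_eq_iff:
  assumes "g \<in> carrier H" "h \<in> carrier H" "v \<in> V"
  shows "R g v = R h v \<longleftrightarrow> g = h"
  using assms by (cases v) auto

lemma right_mult_graph_aut: "g \<in> carrier H \<Longrightarrow> R g \<in> graph_aut \<Gamma>"
  using RH_subset[OF is_group S_subset] by (auto simp: RH_def)

lemma subgroup_N: "subgroup N (GraphAut \<Gamma>)"
  by (rule subgroup_normalizer_RH[OF is_group S_subset])

lemma GraphAut_mult:
  assumes "f \<in> graph_aut \<Gamma>" "g \<in> graph_aut \<Gamma>"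
  shows "f \<otimes>\<^bsub>GraphAut \<Gamma>\<^esub> g = compose V f g"
  using assms by (simp add: GraphAut_def BijGroup_def graph_aut_def)

lemma mem_N_iff:
  "f \<in> N \<longleftrightarrow> f \<in> graph_aut \<Gamma> \<and>
     (\<lambda>g. compose V f (R g)) ` carrier H = (\<lambda>g. compose V (R g) f) ` carrier H"
proof -
  have car: "carrier (GraphAut \<Gamma>) = graph_aut \<Gamma>" by (simp add: GraphAut_def)
  have "f <#\<^bsub>GraphAut \<Gamma>\<^esub> RH H = (\<lambda>g. compose V f (R g)) ` carrier H"
    "RH H #>\<^bsub>GraphAut \<Gamma>\<^esub> f = (\<lambda>g. compose V (R g) f) ` carrier H" if "f \<in> graph_aut \<Gamma>"
    using that by (auto simp: l_coset_def r_coset_def RH_def GraphAut_mult right_mult_graph_aut)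
  then show ?thesis
    using group.mem_normalizer_iff[OF group_GraphAut, of "RH H" \<Gamma> f] RH_subset[OF is_group S_subset]
    unfolding car by metis
qed

lemma N_graph_aut: "f \<in> N \<Longrightarrow> f \<in> graph_aut \<Gamma>"
  by (simp add: mem_N_iff)

lemma N_bij: "f \<in> N \<Longrightarrow> bij_betw f V V"
  using N_graph_aut by (force simp: graph_aut_def Bij_def)

lemma N_closed: "f \<in> N \<Longrightarrow> v \<in> V \<Longrightarrow> f v \<in> V"
  using N_bij by (blast dest: bij_betwE)

lemma N_adj: "f \<in> N \<Longrightarrow> u \<in> V \<Longrightarrow> v \<in> V \<Longrightarrow> adj \<Gamma> (f u) (f v) \<longleftrightarrow> adj \<Gamma> u v"
  using N_graph_aut by (simp add: graph_aut_def)

text \<open>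
  The automorphism of \<open>H\<close> is conjugation by \<open>f\<close> on \<open>R(H)\<close>, transported along
  \<^term>\<open>R\<close>, which reverses products; it is well defined because \<open>R(H)\<close> acts freely on the vertices.
\<close>

lemma N_induces_auto:
  assumes f: "f \<in> N"
  obtains \<sigma> where "\<sigma> \<in> auto H"
    and "\<And>g v. g \<in> carrier H \<Longrightarrow> v \<in> V \<Longrightarrow> f (R g v) = R (\<sigma> g) (f v)"
proof -
  have eq: "(\<lambda>g. compose V f (R g)) ` carrier H = (\<lambda>g. compose V (R g) f) ` carrier H"
    using f by (simp add: mem_N_iff)
  have "\<exists>k \<in> carrier H. \<forall>v \<in> V. f (R g v) = R k (f v)" if "g \<in> carrier H" for g
  proof -
    obtain k where "k \<in> carrier H" "compose V f (R g) = compose V (R k) f"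
      using eq \<open>g \<in> carrier H\<close> by blast
    then show ?thesis by (metis compose_eq)
  qed
  then obtain \<tau> where \<tau>: "\<And>g. g \<in> carrier H \<Longrightarrow> \<tau> g \<in> carrier H"
      "\<And>g v. g \<in> carrier H \<Longrightarrow> v \<in> V \<Longrightarrow> f (R g v) = R (\<tau> g) (f v)"
    by metis
  have one: "Inl \<one> \<in> V" by auto
  note fone = N_closed[OF f one]
  have "\<tau> (g \<otimes> h) = \<tau> g \<otimes> \<tau> h" if "g \<in> carrier H" "h \<in> carrier H" for g h
  proof -
    have "R (\<tau> (g \<otimes> h)) (f (Inl \<one>)) = f (R h (R g (Inl \<one>)))"
      using that \<tau>(2)[OF m_closed[OF that] one] by (simp add: right_mult_mult)
    also have "\<dots> = R (\<tau> h) (R (\<tau> g) (f (Inl \<one>)))"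
      using that by (simp add: \<tau>(2) one right_mult_closed del: right_mult_simps)
    also have "\<dots> = R (\<tau> g \<otimes> \<tau> h) (f (Inl \<one>))"
      using that by (simp add: \<tau>(1) right_mult_mult fone)
    finally show ?thesis using that \<tau>(1) fone by (simp add: right_mult_eq_iff)
  qed
  moreover have "inj_on \<tau> (carrier H)"
  proof (rule inj_onI)
    fix g h assume gh: "g \<in> carrier H" "h \<in> carrier H" "\<tau> g = \<tau> h"
    then have "f (R g (Inl \<one>)) = f (R h (Inl \<one>))" using \<tau>(2) one by metis
    then have "R g (Inl \<one>) = R h (Inl \<one>)"
      using N_bij[OF f] gh right_mult_closed[OF _ one] by (metis bij_betw_def inj_onD)
    then show "g = h" using gh one by (simp add: right_mult_eq_iff)
  qed
  moreover have "k \<in> \<tau> ` carrier H" if k: "k \<in> carrier H" for k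
  proof -
    have "compose V (R k) f \<in> (\<lambda>g. compose V f (R g)) ` carrier H"
      unfolding eq using k by (rule imageI)
    then obtain g where g: "g \<in> carrier H" "compose V f (R g) = compose V (R k) f"
      by (elim imageE) metis
    then have "R (\<tau> g) (f (Inl \<one>)) = R k (f (Inl \<one>))"
      using \<tau>(2)[OF g(1) one] one by (metis compose_eq)
    then show ?thesis using g(1) k \<tau>(1) fone by (auto simp: right_mult_eq_iff)
  qed
  ultimately have "restrict \<tau> (carrier H) \<in> auto H"
    using \<tau>(1) by (auto simp: auto_def Bij_def hom_def bij_betw_def inj_on_def)
  then show thesis by (rule that) (simp add: \<tau>(2))
qed

text \<open>
  As \<open>g\<close> runs through \<open>H\<close>, so does \<open>\<sigma> g\<close>, so the equations \<open>f R(g) = R(\<sigma> g) f\<close> together say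
  that the cosets \<open>f R(H)\<close> and \<open>R(H) f\<close> coincide.
\<close>

lemma equivariant_imp_in_N:
  assumes ext: "f \<in> extensional V" and bij: "bij_betw f V V"
    and adj: "\<And>a b. a \<in> carrier H \<Longrightarrow> b \<in> carrier H \<Longrightarrow>
      adj \<Gamma> (f (Inl a)) (f (Inr b)) \<longleftrightarrow> b \<otimes> inv a \<in> S"
    and side: "\<And>a b. a \<in> carrier H \<Longrightarrow> b \<in> carrier H \<Longrightarrow>
      \<not> adj \<Gamma> (f (Inl a)) (f (Inl b)) \<and> \<not> adj \<Gamma> (f (Inr a)) (f (Inr b))"
    and \<sigma>: "\<sigma> ` carrier H = carrier H"
    and eqv: "\<And>g v. g \<in> carrier H \<Longrightarrow> v \<in> V \<Longrightarrow> f (R g v) = R (\<sigma> g) (f v)"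
  shows "f \<in> N"
proof -
  have "f \<in> graph_aut \<Gamma>"
    using ext bij adj adj[unfolded adj_sym[of "f (Inl _)"]] side
    by (auto simp: graph_aut_def Bij_def)
  moreover have "compose V f (R g) = compose V (R (\<sigma> g)) f" if "g \<in> carrier H" for g
    using eqv[OF that] by (auto simp: compose_def)
  then have "(\<lambda>g. compose V f (R g)) ` carrier H = (\<lambda>k. compose V (R k) f) ` \<sigma> ` carrier H"
    by (auto simp: image_image)
  ultimately show ?thesis by (simp add: mem_N_iff \<sigma>)
qed

lemma right_mult_in_N:
  assumes g: "g \<in> carrier H"
  shows "R g \<in> N"
proof -
  let ?c = "\<lambda>k. inv g \<otimes> k \<otimes> g"
  have eq: "compose V (R g) (R k) = compose V (R (?c k)) (R g)" if "k \<in> carrier H" for k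
  proof -
    \<comment> \<open>Composition reverses products: \<open>R h\<close> after \<open>R g\<close> is \<open>R (g \<otimes> h)\<close>.\<close>
    have "g \<otimes> ?c k = k \<otimes> g" using g that by (simp add: m_assoc[symmetric])
    then show ?thesis
      using g that by (auto simp: compose_def fun_eq_iff right_mult_mult simp del: right_mult_simps)
  qed
  have "k \<in> ?c ` carrier H" if "k \<in> carrier H" for k
    by (rule image_eqI[of _ _ "g \<otimes> k \<otimes> inv g"])
      (use g that in \<open>simp_all add: m_assoc, simp add: m_assoc[symmetric]\<close>)
  then have c: "?c ` carrier H = carrier H" using g by auto
  have "(\<lambda>k. compose V (R g) (R k)) ` carrier H
      = (\<lambda>k. compose V (R k) (R g)) ` ?c ` carrier H"
    unfolding image_image by (rule image_cong) (simp_all add: eq)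
  then have "(\<lambda>k. compose V (R g) (R k)) ` carrier H = (\<lambda>k. compose V (R k) (R g)) ` carrier H"
    unfolding c .
  then show ?thesis using g by (simp add: mem_N_iff right_mult_graph_aut)
qed

section \<open>The elements of the normaliser attached to the conditions on S\<close>

lemma auto_simps:
  assumes "\<sigma> \<in> auto H"
  shows "\<And>x. x \<in> carrier H \<Longrightarrow> \<sigma> x \<in> carrier H"
    and "\<And>x y. x \<in> carrier H \<Longrightarrow> y \<in> carrier H \<Longrightarrow> \<sigma> (x \<otimes> y) = \<sigma> x \<otimes> \<sigma> y"
    and "\<And>x. x \<in> carrier H \<Longrightarrow> \<sigma> (inv x) = inv (\<sigma> x)"
    and "\<sigma> \<one> = \<one>"
    and "\<sigma> ` carrier H = carrier H" and "inj_on \<sigma> (carrier H)"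
proof -
  interpret \<sigma>: group_hom H H \<sigma>
    using assms is_group by (simp add: auto_def group_hom_def group_hom_axioms_def)
  show "\<And>x. x \<in> carrier H \<Longrightarrow> \<sigma> x \<in> carrier H"
    "\<And>x y. x \<in> carrier H \<Longrightarrow> y \<in> carrier H \<Longrightarrow> \<sigma> (x \<otimes> y) = \<sigma> x \<otimes> \<sigma> y"
    "\<And>x. x \<in> carrier H \<Longrightarrow> \<sigma> (inv x) = inv (\<sigma> x)" "\<sigma> \<one> = \<one>"
    by simp_all
  show "\<sigma> ` carrier H = carrier H" "inj_on \<sigma> (carrier H)"
    using assms by (auto simp: auto_def Bij_def bij_betw_def)
qed

lemma auto_surj:
  assumes "\<sigma> \<in> auto H" "k \<in> carrier H"
  shows "\<exists>h \<in> carrier H. \<sigma> h = k"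
proof -
  have "k \<in> \<sigma> ` carrier H" using assms(2) by (simp only: auto_simps(5)[OF assms(1)])
  then show ?thesis by blast
qed

lemma auto_image_eq_iff:
  assumes \<sigma>: "\<sigma> \<in> auto H" and T: "T \<subseteq> carrier H"
  shows "\<sigma> ` S = T \<longleftrightarrow> (\<forall>x \<in> carrier H. \<sigma> x \<in> T \<longleftrightarrow> x \<in> S)"
proof -
  note \<sigma>s = auto_simps[OF \<sigma>]
  have img: "\<sigma> x \<in> \<sigma> ` S \<longleftrightarrow> x \<in> S" if "x \<in> carrier H" for x
    using that \<sigma>s(6) S_subset by (meson inj_on_image_mem_iff)
  have "\<sigma> ` S = T \<longleftrightarrow> (\<forall>y \<in> \<sigma> ` carrier H. y \<in> \<sigma> ` S \<longleftrightarrow> y \<in> T)"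
    unfolding \<sigma>s(5) using T S_subset \<sigma>s(1) by blast
  then show ?thesis using img by auto
qed

text \<open>
  With \<open>x = b a\<^sup>-\<^sup>1\<close>, the right-hand side states that \<open>a\<^sub>0 \<mapsto> (\<sigma> a)\<^sub>0\<close>, \<open>b\<^sub>1 \<mapsto> (z \<sigma> b)\<^sub>1\<close> preserves
  adjacency, since \<open>a\<^sub>0\<close> and \<open>b\<^sub>1\<close> are adjacent exactly if \<open>b a\<^sup>-\<^sup>1\<close> lies in \<open>S\<close>.
\<close>

lemma image_eq_l_coset_iff:
  assumes \<sigma>: "\<sigma> \<in> auto H" and z: "z \<in> carrier H"
  shows "\<sigma> ` S = inv z <# S \<longleftrightarrow> (\<forall>x \<in> carrier H. z \<otimes> \<sigma> x \<in> S \<longleftrightarrow> x \<in> S)"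
proof -
  have "y \<in> inv z <# S \<longleftrightarrow> z \<otimes> y \<in> S" if "y \<in> carrier H" for y
  proof
    assume "y \<in> inv z <# S"
    then show "z \<otimes> y \<in> S"
      using z S_subset by (auto simp: l_coset_def m_assoc[symmetric] subset_iff)
  next
    assume "z \<otimes> y \<in> S"
    then show "y \<in> inv z <# S"
      using z that by (auto simp: l_coset_def m_assoc[symmetric] intro!: bexI)
  qed
  moreover have "inv z <# S \<subseteq> carrier H"
    using z S_subset by (auto simp: l_coset_def)
  ultimately show ?thesis
    using auto_image_eq_iff[OF \<sigma>] auto_simps(1)[OF \<sigma>] by simp
qed

text \<open>
  Here the right-hand side is preservation of adjacency by \<open>a\<^sub>0 \<mapsto> (\<sigma> a)\<^sub>1\<close>, \<open>b\<^sub>1 \<mapsto> (\<sigma> b)\<^sub>0\<close>: for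
  \<open>x = b a\<^sup>-\<^sup>1\<close> the quotient belonging to the image pair is \<open>\<sigma> a (\<sigma> b)\<^sup>-\<^sup>1 = (\<sigma> x)\<^sup>-\<^sup>1\<close>.
\<close>

lemma image_eq_set_inv_iff:
  assumes \<sigma>: "\<sigma> \<in> auto H"
  shows "\<sigma> ` S = set_inv S \<longleftrightarrow> (\<forall>x \<in> carrier H. inv (\<sigma> x) \<in> S \<longleftrightarrow> x \<in> S)"
proof -
  have "y \<in> set_inv S \<longleftrightarrow> inv y \<in> S" if "y \<in> carrier H" for y
    using that S_subset by (force simp: SET_INV_def)
  moreover have "set_inv S \<subseteq> carrier H"
    using S_subset by (auto simp: SET_INV_def)
  ultimately show ?thesis
    using auto_image_eq_iff[OF \<sigma>] auto_simps(1)[OF \<sigma>] by simp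
qed

definition twist :: "('a \<Rightarrow> 'a) \<Rightarrow> 'a \<Rightarrow> 'a + 'a \<Rightarrow> 'a + 'a" where
  "twist \<sigma> z = (\<lambda>v \<in> V. map_sum \<sigma> (\<lambda>h. z \<otimes> \<sigma> h) v)"

definition flip :: "('a \<Rightarrow> 'a) \<Rightarrow> 'a + 'a \<Rightarrow> 'a + 'a" where
  "flip \<sigma> = (\<lambda>v \<in> V. case v of Inl h \<Rightarrow> Inr (\<sigma> h) | Inr h \<Rightarrow> Inl (\<sigma> h))"

lemma twist_simps [simp]:
  "h \<in> carrier H \<Longrightarrow> twist \<sigma> z (Inl h) = Inl (\<sigma> h)"
  "h \<in> carrier H \<Longrightarrow> twist \<sigma> z (Inr h) = Inr (z \<otimes> \<sigma> h)"
  by (auto simp: twist_def)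

lemma flip_simps [simp]:
  "h \<in> carrier H \<Longrightarrow> flip \<sigma> (Inl h) = Inr (\<sigma> h)"
  "h \<in> carrier H \<Longrightarrow> flip \<sigma> (Inr h) = Inl (\<sigma> h)"
  by (auto simp: flip_def)

lemma twist_in_N:
  assumes \<sigma>: "\<sigma> \<in> auto H" and z: "z \<in> carrier H" and S: "\<sigma> ` S = inv z <# S"
  shows "twist \<sigma> z \<in> N"
proof (rule equivariant_imp_in_N[where \<sigma> = \<sigma>])
  note \<sigma>s = auto_simps[OF \<sigma>]
  show "twist \<sigma> z \<in> extensional V" by (simp add: twist_def)
  show "\<sigma> ` carrier H = carrier H" by (rule \<sigma>s)
  show "bij_betw (twist \<sigma> z) V V"
    unfolding bij_betw_def
  proof
    show "inj_on (twist \<sigma> z) V"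
      using z \<sigma>s(1) inj_onD[OF \<sigma>s(6)] by (auto simp: inj_on_def)
    have "Inr k \<in> twist \<sigma> z ` V" if k: "k \<in> carrier H" for k
    proof -
      obtain h where "h \<in> carrier H" "\<sigma> h = inv z \<otimes> k"
        using auto_surj[OF \<sigma>, of "inv z \<otimes> k"] z k by auto
      then show ?thesis
        using z that by (intro image_eqI[of _ _ "Inr h"]) (auto simp: m_assoc[symmetric])
    qed
    moreover have "Inl k \<in> twist \<sigma> z ` V" if k: "k \<in> carrier H" for k
    proof -
      obtain h where "h \<in> carrier H" "\<sigma> h = k" using auto_surj[OF \<sigma> k] by blast
      then show ?thesis by (intro image_eqI[of _ _ "Inl h"]) auto
    qed
    ultimately show "twist \<sigma> z ` V = V" using z \<sigma>s(1) by auto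
  qed
  show "adj \<Gamma> (twist \<sigma> z (Inl a)) (twist \<sigma> z (Inr b)) \<longleftrightarrow> b \<otimes> inv a \<in> S"
    if "a \<in> carrier H" "b \<in> carrier H" for a b
  proof -
    have "z \<otimes> \<sigma> (b \<otimes> inv a) \<in> S \<longleftrightarrow> b \<otimes> inv a \<in> S"
      using S that image_eq_l_coset_iff[OF \<sigma> z] by simp
    then show ?thesis using that z \<sigma>s by (simp add: m_assoc)
  qed
  show "\<not> adj \<Gamma> (twist \<sigma> z (Inl a)) (twist \<sigma> z (Inl b)) \<and>
      \<not> adj \<Gamma> (twist \<sigma> z (Inr a)) (twist \<sigma> z (Inr b))"
    if "a \<in> carrier H" "b \<in> carrier H" for a b
    using that by simp
  show "twist \<sigma> z (R g v) = R (\<sigma> g) (twist \<sigma> z v)" if "g \<in> carrier H" "v \<in> V" for g v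
    using that z \<sigma>s by (cases v) (auto simp: m_assoc)
qed

lemma flip_in_N:
  assumes \<sigma>: "\<sigma> \<in> auto H" and S: "\<sigma> ` S = set_inv S"
  shows "flip \<sigma> \<in> N"
proof (rule equivariant_imp_in_N[where \<sigma> = \<sigma>])
  note \<sigma>s = auto_simps[OF \<sigma>]
  show "flip \<sigma> \<in> extensional V" by (simp add: flip_def)
  show "\<sigma> ` carrier H = carrier H" by (rule \<sigma>s)
  show "bij_betw (flip \<sigma>) V V"
    unfolding bij_betw_def
  proof
    show "inj_on (flip \<sigma>) V"
      using inj_onD[OF \<sigma>s(6)] by (auto simp: inj_on_def)
    have "Inr k \<in> flip \<sigma> ` V" "Inl k \<in> flip \<sigma> ` V" if k: "k \<in> carrier H" for k
    proof -
      obtain h where "h \<in> carrier H" "\<sigma> h = k" using auto_surj[OF \<sigma> k] by blast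
      then show "Inr k \<in> flip \<sigma> ` V" "Inl k \<in> flip \<sigma> ` V"
        by (auto intro: image_eqI[of _ _ "Inl h"] image_eqI[of _ _ "Inr h"])
    qed
    then show "flip \<sigma> ` V = V" using \<sigma>s(1) by auto
  qed
  show "adj \<Gamma> (flip \<sigma> (Inl a)) (flip \<sigma> (Inr b)) \<longleftrightarrow> b \<otimes> inv a \<in> S"
    if "a \<in> carrier H" "b \<in> carrier H" for a b
  proof -
    have "inv (\<sigma> (b \<otimes> inv a)) \<in> S \<longleftrightarrow> b \<otimes> inv a \<in> S"
      using S that image_eq_set_inv_iff[OF \<sigma>] by simp
    then show ?thesis using that \<sigma>s by (simp add: inv_mult_group)
  qed
  show "\<not> adj \<Gamma> (flip \<sigma> (Inl a)) (flip \<sigma> (Inl b)) \<and> \<not> adj \<Gamma> (flip \<sigma> (Inr a)) (flip \<sigma> (Inr b))"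
    if "a \<in> carrier H" "b \<in> carrier H" for a b
    using that by simp
  show "flip \<sigma> (R g v) = R (\<sigma> g) (flip \<sigma> v)" if "g \<in> carrier H" "v \<in> V" for g v
    using that \<sigma>s by (cases v) auto
qed

text \<open>
  Conversely, equivariance determines \<open>f\<close> from its values at \<open>1\<^sub>0\<close> and \<open>1\<^sub>1\<close>, as \<open>h\<^sub>i\<close> is the image of
  \<open>1\<^sub>i\<close> under \<open>R h\<close>; the edges at \<open>1\<^sub>0\<close> then give the equation for \<open>\<sigma> S\<close>. In particular \<open>f\<close>
  preserves or exchanges the two copies of \<open>H\<close> as soon as it does so for \<open>1\<^sub>0\<close> and \<open>1\<^sub>1\<close>.
\<close>

lemma N_fixing_Inl_one:
  assumes f: "f \<in> N" and "f (Inl \<one>) = Inl \<one>" "f (Inr \<one>) = Inr z"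
  obtains \<sigma> where "\<sigma> \<in> auto H" "\<sigma> ` S = inv z <# S"
    and "\<And>h. h \<in> carrier H \<Longrightarrow> f (Inl h) = Inl (\<sigma> h)"
    and "\<And>h. h \<in> carrier H \<Longrightarrow> f (Inr h) = Inr (z \<otimes> \<sigma> h)"
proof -
  obtain \<sigma> where \<sigma>: "\<sigma> \<in> auto H"
    and eqv: "\<And>g v. g \<in> carrier H \<Longrightarrow> v \<in> V \<Longrightarrow> f (R g v) = R (\<sigma> g) (f v)"
    using N_induces_auto[OF f] by metis
  note \<sigma>s = auto_simps[OF \<sigma>]
  have z: "z \<in> carrier H" using N_closed[OF f, of "Inr \<one>"] assms(3) by auto
  have l: "f (Inl h) = Inl (\<sigma> h)" and r: "f (Inr h) = Inr (z \<otimes> \<sigma> h)" if "h \<in> carrier H" for h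
    using eqv[OF that, of "Inl \<one>"] eqv[OF that, of "Inr \<one>"] assms(2,3) that z \<sigma>s(1) by auto
  have "z \<otimes> \<sigma> x \<in> S \<longleftrightarrow> x \<in> S" if "x \<in> carrier H" for x
    using N_adj[OF f, of "Inl \<one>" "Inr x"] that z \<sigma>s(1) assms(2) r by simp
  then have "\<sigma> ` S = inv z <# S" using image_eq_l_coset_iff[OF \<sigma> z] by blast
  then show thesis using that \<sigma> l r by blast
qed

lemma N_swapping_ones:
  assumes f: "f \<in> N" and "f (Inl \<one>) = Inr \<one>" "f (Inr \<one>) = Inl \<one>"
  obtains \<sigma> where "\<sigma> \<in> auto H" "\<sigma> ` S = set_inv S"
proof -
  obtain \<sigma> where \<sigma>: "\<sigma> \<in> auto H"
    and eqv: "\<And>g v. g \<in> carrier H \<Longrightarrow> v \<in> V \<Longrightarrow> f (R g v) = R (\<sigma> g) (f v)"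
    using N_induces_auto[OF f] by metis
  note \<sigma>s = auto_simps[OF \<sigma>]
  have r: "f (Inr h) = Inl (\<sigma> h)" if "h \<in> carrier H" for h
    using eqv[OF that, of "Inr \<one>"] assms(3) that \<sigma>s(1) by simp
  have "inv (\<sigma> x) \<in> S \<longleftrightarrow> x \<in> S" if "x \<in> carrier H" for x
    using N_adj[OF f, of "Inl \<one>" "Inr x"] that \<sigma>s(1) assms(2) r by simp
  then have "\<sigma> ` S = set_inv S" using image_eq_set_inv_iff[OF \<sigma>] by blast
  then show thesis using that \<sigma> by blast
qed

section \<open>Transitivity on arcs\<close>

lemma l_coset_one: "inv \<one> <# S = S"
  using S_subset by (auto simp: l_coset_def subset_iff)

lemma aut_set_stabilizer_minus_one:
  "\<sigma> \<in> aut_set_stabilizer H (S - {\<one>}) \<longleftrightarrow> \<sigma> \<in> auto H \<and> \<sigma> ` S = S"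
proof -
  have "\<sigma> ` (S - {\<one>}) = S - {\<one>} \<longleftrightarrow> \<sigma> ` S = S" if \<sigma>: "\<sigma> \<in> auto H"
  proof -
    have diff: "\<sigma> ` (S - {\<one>}) = \<sigma> ` S - {\<one>}"
      using inj_on_image_set_diff[OF auto_simps(6)[OF \<sigma>], of S "{\<one>}"] S_subset auto_simps(4)[OF \<sigma>]
      by auto
    have one: "\<one> \<in> \<sigma> ` S"
      using one_in_S auto_simps(4)[OF \<sigma>] by (metis image_eqI)
    show ?thesis
      unfolding diff using one one_in_S by (metis insert_Diff)
  qed
  then show ?thesis
    unfolding aut_set_stabilizer_def by blast
qed

lemma acts_transitively_stabilizer_iff:
  "acts_transitively (AutoGroup H \<lparr>carrier := aut_set_stabilizer H (S - {\<one>})\<rparr>)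
      (S - {\<one>}) (\<lambda>\<sigma>. restrict \<sigma> (S - {\<one>})) \<longleftrightarrow>
    S - {\<one>} \<noteq> {} \<and> (\<forall>x \<in> S - {\<one>}. \<forall>y \<in> S - {\<one>}. \<exists>\<sigma> \<in> auto H. \<sigma> ` S = S \<and> \<sigma> x = y)"
  using group_action_aut_set_stabilizer[OF is_group, of "S - {\<one>}"] S_subset
  by (auto simp: acts_transitively_def transitive_action_def transitive_action_axioms_def
      aut_set_stabilizer_minus_one Bex_def)

lemma two_arc_imp_nontrivial:
  assumes uvw: "{u, v, w} \<subseteq> V" "adj \<Gamma> u v" "adj \<Gamma> v w" "u \<noteq> w"
  shows "S \<noteq> {\<one>}"
proof
  assume S1: "S = {\<one>}"
  have "b \<otimes> inv a \<in> S \<longleftrightarrow> a = b" if "a \<in> carrier H" "b \<in> carrier H" for a b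
    using that by (auto simp: S1) (metis inv_closed inv_equality inv_inv)
  then show False
    using uvw by (cases u; cases v; cases w) simp_all
qed

lemma arcs_2_Inl_one_iff:
  assumes "x \<in> carrier H" "y \<in> carrier H"
  shows "[Inr x, Inl \<one>, Inr y] \<in> arcs \<Gamma> 2 \<longleftrightarrow> x \<in> S \<and> y \<in> S \<and> x \<noteq> y"
  using assms by (auto simp: arcs_2_iff)

definition same_orbit :: "('a + 'a) list \<Rightarrow> ('a + 'a) list \<Rightarrow> bool" where
  "same_orbit p q \<longleftrightarrow> (\<exists>f \<in> N. map f p = q)"

lemma same_orbitI: "f \<in> N \<Longrightarrow> map f p = q \<Longrightarrow> same_orbit p q"
  by (auto simp: same_orbit_def)

lemma same_orbit_arcs: "same_orbit p q \<Longrightarrow> p \<in> arcs \<Gamma> s \<Longrightarrow> q \<in> arcs \<Gamma> s"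
  by (auto simp: same_orbit_def N_graph_aut intro: arcs_map)

lemma same_orbit_trans:
  assumes "same_orbit p q" "same_orbit q r" "p \<in> arcs \<Gamma> s"
  shows "same_orbit p r"
proof -
  obtain f g where fg: "f \<in> N" "g \<in> N" "q = map f p" "r = map g q"
    using assms by (auto simp: same_orbit_def)
  have "compose V g f \<in> N"
    using subgroup.m_closed[OF subgroup_N fg(2,1)] fg(1,2) by (simp add: GraphAut_mult N_graph_aut)
  moreover have "map (compose V g f) p = r"
    using fg assms(3) by (auto simp: arcs_def compose_eq)
  ultimately show ?thesis by (rule same_orbitI)
qed

lemma same_orbit_sym:
  assumes "same_orbit p q" "p \<in> arcs \<Gamma> s"
  shows "same_orbit q p"
proof -
  interpret act: group_action "GraphAut \<Gamma> \<lparr>carrier := N\<rparr>" "arcs \<Gamma> s" "arc_action \<Gamma> s"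
    by (rule group_action_arcs[OF subgroup_N])
  obtain f where f: "f \<in> N" "map f p = q" using assms by (auto simp: same_orbit_def)
  have q: "q \<in> arcs \<Gamma> s" using same_orbit_arcs[OF assms] .
  have "arc_action \<Gamma> s f p = q" using f assms(2) by (simp add: arc_action_def)
  then have "q \<in> orbit (GraphAut \<Gamma> \<lparr>carrier := N\<rparr>) (arc_action \<Gamma> s) p"
    using f by (auto simp: orbit_def)
  then have "p \<in> orbit (GraphAut \<Gamma> \<lparr>carrier := N\<rparr>) (arc_action \<Gamma> s) q"
    using act.orbit_sym assms(2) q by blast
  then show ?thesis using q by (auto simp: orbit_def arc_action_def same_orbit_def)
qed

text \<open>
  In the backward direction the 2-arcs centred at \<open>1\<^sub>0\<close> are the pairs of distinct elements of \<open>S\<close>,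
  and the base arc is \<open>(1, s)\<close> for the \<open>s\<close> of condition (c). A pair \<open>(x, y)\<close> with \<open>x \<noteq> 1\<close> is moved
  to some \<open>(s, y')\<close> by (b), then to some \<open>(1, t)\<close> by the inverse of the map from (c), and then
  to \<open>(1, s)\<close> by (b) again.
\<close>

lemma transitive_on_arcs_2_iff:
  "transitive_on_arcs \<Gamma> N 2 \<longleftrightarrow>
    (\<exists>\<alpha> \<in> auto H. \<alpha> ` S = set_inv S) \<and>
    acts_transitively (AutoGroup H \<lparr>carrier := aut_set_stabilizer H (S - {\<one>})\<rparr>)
      (S - {\<one>}) (\<lambda>\<alpha>. restrict \<alpha> (S - {\<one>})) \<and>
    (\<exists>s \<in> S - {\<one>}. \<exists>\<beta> \<in> auto H. \<beta> ` S = inv s <# S)" (is "?T \<longleftrightarrow> ?a \<and> ?b \<and> ?c")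
proof
  assume ?T
  then have ne: "arcs \<Gamma> 2 \<noteq> {}"
    and tr: "\<And>p q. p \<in> arcs \<Gamma> 2 \<Longrightarrow> q \<in> arcs \<Gamma> 2 \<Longrightarrow> \<exists>f \<in> N. map f p = q"
    by (auto simp: transitive_on_arcs_iff[OF subgroup_N])
  have arc: "[Inr \<one>, Inl \<one>, Inr s] \<in> arcs \<Gamma> 2" "[Inr s, Inl \<one>, Inr \<one>] \<in> arcs \<Gamma> 2"
    if "s \<in> S - {\<one>}" for s
    using that one_in_S S_subset by (auto simp: arcs_2_Inl_one_iff subset_iff)
  obtain p where "p \<in> arcs \<Gamma> 2" using ne by blast
  then obtain u v w where "{u, v, w} \<subseteq> V" "adj \<Gamma> u v" "adj \<Gamma> v w" "u \<noteq> w"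
    unfolding arcs_2_iff verts_bicay by (elim exE conjE) metis
  then have "S \<noteq> {\<one>}" by (rule two_arc_imp_nontrivial)
  then obtain s where s: "s \<in> S - {\<one>}" using one_in_S by blast
  then have sc: "s \<in> carrier H" using S_subset by blast
  have ?a
  proof -
    have "[Inl \<one>, Inr \<one>, Inl (inv s)] \<in> arcs \<Gamma> 2"
      using s sc one_in_S inv_eq_1_iff[OF sc] by (auto simp: arcs_2_iff dest!: sym[of \<one>])
    then obtain f where "f \<in> N" "f (Inl \<one>) = Inr \<one>" "f (Inr \<one>) = Inl \<one>"
      using tr[OF arc(1)[OF s]] by auto
    then show ?thesis by (rule N_swapping_ones) blast
  qed
  moreover have ?b
    unfolding acts_transitively_stabilizer_iff
  proof (intro conjI ballI)
    show "S - {\<one>} \<noteq> {}" using s by blast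
    fix x y assume x: "x \<in> S - {\<one>}" and y: "y \<in> S - {\<one>}"
    obtain f where f: "f \<in> N" "f (Inl \<one>) = Inl \<one>" "f (Inr \<one>) = Inr \<one>" "f (Inr x) = Inr y"
      using tr[OF arc(1)[OF x] arc(1)[OF y]] by auto
    obtain \<sigma> where \<sigma>: "\<sigma> \<in> auto H" "\<sigma> ` S = inv \<one> <# S"
      "\<And>h. h \<in> carrier H \<Longrightarrow> f (Inr h) = Inr (\<one> \<otimes> \<sigma> h)"
      using N_fixing_Inl_one[OF f(1-3)] by metis
    have "x \<in> carrier H" using x S_subset by blast
    then have "\<sigma> x = y" using \<sigma>(3) f(4) auto_simps(1)[OF \<sigma>(1)] by simp
    then show "\<exists>\<sigma> \<in> auto H. \<sigma> ` S = S \<and> \<sigma> x = y" using \<sigma>(1,2) l_coset_one by auto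
  qed
  moreover have ?c
  proof -
    obtain f where "f \<in> N" "f (Inl \<one>) = Inl \<one>" "f (Inr \<one>) = Inr s"
      using tr[OF arc[OF s]] by auto
    then obtain \<beta> where "\<beta> \<in> auto H" "\<beta> ` S = inv s <# S"
      using N_fixing_Inl_one by metis
    then show ?thesis using s by blast
  qed
  ultimately show "?a \<and> ?b \<and> ?c" by blast
next
  assume abc: "?a \<and> ?b \<and> ?c"
  then obtain \<alpha> where \<alpha>: "\<alpha> \<in> auto H" "\<alpha> ` S = set_inv S" by blast
  obtain s \<beta> where s: "s \<in> S - {\<one>}" and \<beta>: "\<beta> \<in> auto H" "\<beta> ` S = inv s <# S"
    using abc by blast
  have b: "\<exists>\<sigma> \<in> auto H. \<sigma> ` S = S \<and> \<sigma> x = y" if "x \<in> S - {\<one>}" "y \<in> S - {\<one>}" for x y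
    using abc that unfolding acts_transitively_stabilizer_iff by blast
  have Sc: "x \<in> carrier H" if "x \<in> S" for x using that S_subset by blast
  have sc: "s \<in> carrier H" using s Sc by blast
  let ?p0 = "[Inr \<one>, Inl \<one>, Inr s]"
  have p0: "?p0 \<in> arcs \<Gamma> 2"
    using s sc one_in_S by (auto simp: arcs_2_Inl_one_iff)
  have start_one: "same_orbit [Inr \<one>, Inl \<one>, Inr y] ?p0" if y: "y \<in> S - {\<one>}" for y
  proof -
    obtain \<sigma> where \<sigma>: "\<sigma> \<in> auto H" "\<sigma> ` S = S" "\<sigma> y = s" using b[OF y s] by blast
    have "twist \<sigma> \<one> \<in> N" using twist_in_N[OF \<sigma>(1)] \<sigma>(2) l_coset_one by simp
    then show ?thesis
      by (rule same_orbitI) (use y \<sigma>(3) auto_simps[OF \<sigma>(1)] Sc sc in simp)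
  qed
  have start_s: "same_orbit [Inr s, Inl \<one>, Inr y] ?p0" if y: "y \<in> S" "y \<noteq> s" for y
  proof -
    \<comment> \<open>The vertex \<open>t\<^sub>1\<close> is the preimage of \<open>y\<^sub>1\<close> under the map from (c).\<close>
    have "inv s \<otimes> y \<in> \<beta> ` S" using \<beta>(2) y by (auto simp: l_coset_def)
    then obtain t where t: "t \<in> S" "\<beta> t = inv s \<otimes> y" by auto
    have "t \<noteq> \<one>"
    proof
      assume "t = \<one>"
      then have "\<one> = inv s \<otimes> y" using t(2) auto_simps(4)[OF \<beta>(1)] by simp
      then show False using y sc Sc by (metis inv_solve_left r_one one_closed)
    qed
    have arc: "[Inr \<one>, Inl \<one>, Inr t] \<in> arcs \<Gamma> 2"
      using t \<open>t \<noteq> \<one>\<close> Sc one_in_S by (auto simp: arcs_2_Inl_one_iff)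
    have "same_orbit [Inr \<one>, Inl \<one>, Inr t] [Inr s, Inl \<one>, Inr y]"
      by (rule same_orbitI[OF twist_in_N[OF \<beta>(1) sc \<beta>(2)]])
        (use t y Sc sc auto_simps(4)[OF \<beta>(1)] in \<open>simp add: m_assoc[symmetric]\<close>)
    then have "same_orbit [Inr s, Inl \<one>, Inr y] [Inr \<one>, Inl \<one>, Inr t]"
      using same_orbit_sym arc by blast
    moreover have "[Inr s, Inl \<one>, Inr y] \<in> arcs \<Gamma> 2"
      using y s sc Sc by (auto simp: arcs_2_Inl_one_iff)
    ultimately show ?thesis
      using start_one t(1) \<open>t \<noteq> \<one>\<close> same_orbit_trans by blast
  qed
  have centre_one: "same_orbit [Inr x, Inl \<one>, Inr y] ?p0" if xy: "x \<in> S" "y \<in> S" "x \<noteq> y" for x y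
  proof (cases "x = \<one>")
    case True
    then show ?thesis using start_one xy by auto
  next
    case False
    then obtain \<sigma> where \<sigma>: "\<sigma> \<in> auto H" "\<sigma> ` S = S" "\<sigma> x = s" using b[of x s] xy s by blast
    have "twist \<sigma> \<one> \<in> N" using twist_in_N[OF \<sigma>(1)] \<sigma>(2) l_coset_one by simp
    then have "same_orbit [Inr x, Inl \<one>, Inr y] [Inr s, Inl \<one>, Inr (\<sigma> y)]"
      by (rule same_orbitI) (use xy \<sigma>(3) auto_simps[OF \<sigma>(1)] Sc sc in simp)
    moreover have "\<sigma> y \<in> S" using xy \<sigma>(2) by blast
    moreover have "\<sigma> y \<noteq> s" using xy Sc \<sigma>(3) auto_simps(6)[OF \<sigma>(1)] by (metis inj_onD)
    moreover have "[Inr x, Inl \<one>, Inr y] \<in> arcs \<Gamma> 2"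
      using xy Sc by (auto simp: arcs_2_Inl_one_iff)
    ultimately show ?thesis using start_s same_orbit_trans by blast
  qed
  have centre_Inl: "same_orbit [u, Inl a, w] ?p0" if arc: "[u, Inl a, w] \<in> arcs \<Gamma> 2" for u a w
  proof -
    have a: "a \<in> carrier H" using arc by (auto simp: arcs_2_iff)
    obtain x y where xy: "u = Inr x" "w = Inr y" "x \<in> carrier H" "y \<in> carrier H"
      using arc a by (cases u; cases w) (auto simp: arcs_2_iff)
    let ?q = "[Inr (x \<otimes> inv a), Inl \<one>, Inr (y \<otimes> inv a)]"
    have q: "same_orbit [u, Inl a, w] ?q"
      by (rule same_orbitI[OF right_mult_in_N[of "inv a"]]) (use a xy in simp_all)
    then have "?q \<in> arcs \<Gamma> 2" using same_orbit_arcs arc by blast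
    then have "same_orbit ?q ?p0" using a xy by (intro centre_one) (simp_all add: arcs_2_Inl_one_iff)
    then show ?thesis using same_orbit_trans[OF q _ arc] by blast
  qed
  have all: "same_orbit p ?p0" if p: "p \<in> arcs \<Gamma> 2" for p
  proof -
    obtain u v w where uvw: "p = [u, v, w]" using p by (auto simp: arcs_2_iff)
    show ?thesis
    proof (cases v)
      case (Inl a)
      then show ?thesis using centre_Inl p uvw by simp
    next
      case (Inr a)
      have a: "a \<in> carrier H" using p uvw Inr by (auto simp: arcs_2_iff)
      have q: "same_orbit p [flip \<alpha> u, Inl (\<alpha> a), flip \<alpha> w]"
        by (rule same_orbitI[OF flip_in_N[OF \<alpha>]]) (simp add: uvw Inr a)
      then show ?thesis using same_orbit_trans[OF q _ p] centre_Inl same_orbit_arcs[OF q p] by blast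
    qed
  qed
  then have "same_orbit p q" if "p \<in> arcs \<Gamma> 2" "q \<in> arcs \<Gamma> 2" for p q
    using that same_orbit_sym same_orbit_trans by blast
  then show ?T
    using p0 by (auto simp: transitive_on_arcs_iff[OF subgroup_N] same_orbit_def)
qed

text \<open>
  Both ends of \<open>(x\<^sub>1, 1\<^sub>0, 1\<^sub>1, (t\<^sup>-\<^sup>1)\<^sub>0)\<close> are governed by one automorphism, so elements of
  \<open>N\<close> preserve the truth value of \<open>t = x\<close>, and both values occur once \<open>S - {1}\<close> has two elements. The case
  \<open>|S| = 2\<close> is a genuine exception: a connected graph is then a cycle, and a group transitive on the
  2-arcs of a cycle is transitive on its longer arcs. If \<open>S = {1}\<close>, there are no 3-arcs at all.
\<close>

lemma not_transitive_on_arcs_3: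
  assumes "card S \<noteq> 2"
  shows "\<not> transitive_on_arcs \<Gamma> N 3"
proof
  assume T: "transitive_on_arcs \<Gamma> N 3"
  have Sc: "x \<in> carrier H" if "x \<in> S" for x using that S_subset by blast
  have arc: "[Inr x, Inl \<one>, Inr \<one>, Inl (inv t)] \<in> arcs \<Gamma> 3"
    if "x \<in> S - {\<one>}" "t \<in> S - {\<one>}" for x t
    using that Sc one_in_S inv_eq_1_iff[of t] by (auto simp: arcs_3_iff dest!: sym[of \<one>])
  show False
  proof (cases "S = {\<one>}")
    case True
    obtain p where p: "p \<in> arcs \<Gamma> 3" using T by (auto simp: transitive_on_arcs_iff[OF subgroup_N])
    then obtain u v w x where "p = [u, v, w, x]"
      by (auto simp: arcs_def length_Suc_conv numeral_eq_Suc)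
    then have "{u, v, w} \<subseteq> V" "adj \<Gamma> u v" "adj \<Gamma> v w" "u \<noteq> w"
      using p by (auto simp: arcs_3_iff)
    then show False using two_arc_imp_nontrivial True by blast
  next
    case False
    then obtain x where x: "x \<in> S - {\<one>}" using one_in_S by blast
    moreover have "S \<noteq> {\<one>, x}" using assms x by auto
    ultimately obtain t where t: "t \<in> S - {\<one>}" "t \<noteq> x" using one_in_S by blast
    obtain f where f: "f \<in> N" "f (Inl \<one>) = Inl \<one>" "f (Inr \<one>) = Inr \<one>"
        "f (Inr x) = Inr x" "f (Inl (inv x)) = Inl (inv t)"
      using T arc[OF x x] arc[OF x t(1)]
      by (fastforce simp: transitive_on_arcs_iff[OF subgroup_N])
    obtain \<sigma> where \<sigma>: "\<sigma> \<in> auto H"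
      "\<And>h. h \<in> carrier H \<Longrightarrow> f (Inl h) = Inl (\<sigma> h)"
      "\<And>h. h \<in> carrier H \<Longrightarrow> f (Inr h) = Inr (\<one> \<otimes> \<sigma> h)"
      using N_fixing_Inl_one[OF f(1-3)] by metis
    have xt: "x \<in> carrier H" "t \<in> carrier H" using x t Sc by auto
    have "\<sigma> x = x" using \<sigma>(3)[OF xt(1)] f(4) auto_simps(1)[OF \<sigma>(1)] xt by simp
    moreover have "inv (\<sigma> x) = inv t"
      using \<sigma>(2)[of "inv x"] f(5) xt auto_simps(3)[OF \<sigma>(1)] by simp
    ultimately show False using xt t(2) by (metis inv_inv)
  qed
qed

end

theorem theorem1p1:
  fixes H :: "('a, 'm) monoid_scheme" and S :: "'a set"
  defines "\<Gamma> \<equiv> bicay H S"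
  defines "N \<equiv> normalizer (GraphAut \<Gamma>) (RH H)"
  assumes "group H" and "finite (carrier H)"
    and "S \<subseteq> carrier H" and "\<one>\<^bsub>H\<^esub> \<in> S"
    and "graph_connected \<Gamma>"
  shows "(transitive_on_arcs \<Gamma> N 2 \<longleftrightarrow>
            (\<exists>\<alpha> \<in> auto H. \<alpha> ` S = set_inv\<^bsub>H\<^esub> S) \<and>
            acts_transitively (AutoGroup H \<lparr>carrier := aut_set_stabilizer H (S - {\<one>\<^bsub>H\<^esub>})\<rparr>)
              (S - {\<one>\<^bsub>H\<^esub>}) (\<lambda>\<alpha>. restrict \<alpha> (S - {\<one>\<^bsub>H\<^esub>})) \<and>
            (\<exists>s \<in> S - {\<one>\<^bsub>H\<^esub>}. \<exists>\<beta> \<in> auto H. \<beta> ` S = inv\<^bsub>H\<^esub> s <#\<^bsub>H\<^esub> S))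
       \<and> (card S \<noteq> 2 \<longrightarrow> \<not> transitive_on_arcs \<Gamma> N 3)"
proof -
  interpret bicayley H S
    using assms by (simp add: bicayley_def bicayley_axioms_def)
  show ?thesis
    unfolding \<Gamma>_def N_def using transitive_on_arcs_2_iff not_transitive_on_arcs_3 by blast
qed

end
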